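(* Let $A$ and $B$ be fixed finitely generated abelian groups. The Diophantine problem for the class of orientable quadratic equations over $A\wr B$ of the form $$\prod_{i=1}^g[x_i,y_i]\prod_{j=1}^m z_j^{-1}c_jz_j=1,\qquad g\ge 1,\ m\ge 0,$$ with genus satisfying $g\ge \operatorname{rank}(B)/2$, is in $\mathbf{P}$. That is, given such $g$, $m$ and constants $c_1,\dots,c_m\in A\wr B$, one can decide in polynomial time whether there exist $x_i,y_i,z_j\in A\wr B$ satisfying the equation.
   Context: Wreath product: for finitely generated abelian groups $A,B$ (written additively), $A^B$ is the group of finitely supported functions $f\colon B\to A$ under pointwise addition; for $f\in A^B$, $b\in B$ put $f^b(x)=f(b+x)$. Then $A\wr B=B\ltimes A^B$ with multiplication $(\delta_1,f_1)(\delta_2,f_2)=(\delta_1+\delta_2,\,f_1^{\delta_2}+f_2)$. An element $a\in A$ is identified with $(0,f)$, where $f(0)=a$ and $f(x)=0$ for $x\ne 0$; an element $b\in B$ is identified with $(b,0)$. Generators of $A$ and of $B$ together generate $A\wr B$. Conventions: $\operatorname{rank}(B)$ is the minimum number of generators of $B$; $[x,y]=x^{-1}y^{-1}xy$; $x_i,y_i,z_j$ are distinct variables. Constants are given as words in a fixed finite set of generators of $A$ and $B$ and their inverses; the size of an equation is the length of its left-hand side as a word. The model of computation is a random-access machine. *)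

theory Defs
  imports
    "HOL-Algebra.Group"
    "HOL-Computational_Algebra.Group_Closure"
    "HOL-Computational_Algebra.Polynomial"
begin

subsection \<open>Wreath products of abelian groups\<close>

definition shift :: "('b::ab_group_add \<Rightarrow> 'a) \<Rightarrow> 'b \<Rightarrow> 'b \<Rightarrow> 'a" where
  "shift f b = (\<lambda>x. f (b + x))"

definition wreath :: "('b::ab_group_add \<times> ('b \<Rightarrow> 'a::ab_group_add)) monoid" where
  "wreath =
    \<lparr> carrier = {(\<delta>, f). finite {x. f x \<noteq> 0}},
      monoid.mult = (\<lambda>(\<delta>\<^sub>1, f\<^sub>1) (\<delta>\<^sub>2, f\<^sub>2). (\<delta>\<^sub>1 + \<delta>\<^sub>2, \<lambda>x. shift f\<^sub>1 \<delta>\<^sub>2 x + f\<^sub>2 x)),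
      one = (0, \<lambda>x. 0) \<rparr>"

definition embed_A :: "'a::ab_group_add \<Rightarrow> 'b::ab_group_add \<times> ('b \<Rightarrow> 'a)" where
  "embed_A a = (0, \<lambda>x. if x = 0 then a else 0)"

definition embed_B :: "'b::ab_group_add \<Rightarrow> 'b \<times> ('b \<Rightarrow> 'a::ab_group_add)" where
  "embed_B b = (b, \<lambda>x. 0)"

text \<open>The minimum number of generators; meaningful only for finitely generated \<open>H\<close>.\<close>

definition group_rank :: "'b::ab_group_add set \<Rightarrow> nat" where
  "group_rank H = (LEAST n. \<exists>S. finite S \<and> card S = n \<and> group_closure S = H)"

lemma finite_support_shift:
  fixes f :: "'b::ab_group_add \<Rightarrow> 'a::zero"
  assumes "finite {x. f x \<noteq> 0}"
  shows "finite {x. shift f b x \<noteq> 0}"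
proof -
  have "{x. shift f b x \<noteq> 0} \<subseteq> (\<lambda>y. y - b) ` {x. f x \<noteq> 0}"
  proof
    fix x assume "x \<in> {x. shift f b x \<noteq> 0}"
    then show "x \<in> (\<lambda>y. y - b) ` {x. f x \<noteq> 0}"
      by (intro image_eqI[of _ _ "b + x"]) (auto simp: shift_def)
  qed
  then show ?thesis
    using assms finite_surj by blast
qed

lemma group_wreath: "group (wreath :: ('b::ab_group_add \<times> ('b \<Rightarrow> 'a::ab_group_add)) monoid)"
proof (rule groupI)
  fix u v :: "'b \<times> ('b \<Rightarrow> 'a)"
  assume "u \<in> carrier wreath" "v \<in> carrier wreath"
  then obtain b f c h where uv: "u = (b, f)" "v = (c, h)"
      and fin: "finite {x. f x \<noteq> 0}" "finite {x. h x \<noteq> 0}"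
    by (auto simp: wreath_def)
  have "{x. shift f c x + h x \<noteq> 0} \<subseteq> {x. shift f c x \<noteq> 0} \<union> {x. h x \<noteq> 0}"
    by auto
  with fin finite_support_shift[of f c] have "finite {x. shift f c x + h x \<noteq> 0}"
    using finite_subset by blast
  then show "u \<otimes>\<^bsub>wreath\<^esub> v \<in> carrier wreath"
    by (simp add: wreath_def uv)
next
  fix u :: "'b \<times> ('b \<Rightarrow> 'a)"
  assume "u \<in> carrier wreath"
  then obtain b f where u: "u = (b, f)" and fin: "finite {x. f x \<noteq> 0}"
    by (auto simp: wreath_def)
  define v where "v = (- b, \<lambda>x. - shift f (- b) x)"
  have "v \<in> carrier wreath"
    using finite_support_shift[OF fin, of "- b"] by (simp add: wreath_def v_def)
  moreover have "v \<otimes>\<^bsub>wreath\<^esub> u = \<one>\<^bsub>wreath\<^esub>"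
    by (simp add: wreath_def v_def u shift_def fun_eq_iff)
  ultimately show "\<exists>v\<in>carrier wreath. v \<otimes>\<^bsub>wreath\<^esub> u = \<one>\<^bsub>wreath\<^esub>"
    by blast
qed (auto simp: wreath_def shift_def fun_eq_iff algebra_simps)


subsection \<open>Words and quadratic equations\<close>

datatype 's letter = Pos 's | Inv 's

text \<open>
  \<open>GA k\<close> and \<open>GB k\<close> name the \<open>k\<close>-th elements of fixed lists of generators of \<open>A\<close> and of \<open>B\<close>.
\<close>

datatype gen = GA nat | GB nat

datatype var = X nat | Y nat | Z nat

datatype sym = Var var | Gen gen

fun gen_ok :: "'a list \<Rightarrow> 'b list \<Rightarrow> gen \<Rightarrow> bool" where
  "gen_ok as bs (GA k) \<longleftrightarrow> k < length as"
| "gen_ok as bs (GB k) \<longleftrightarrow> k < length bs"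

definition const_words :: "'a list \<Rightarrow> 'b list \<Rightarrow> gen letter list set" where
  "const_words as bs = {c. \<forall>l\<in>set c. \<forall>s\<in>set_letter l. gen_ok as bs s}"

definition commutator_word :: "nat \<Rightarrow> sym letter list" where
  "commutator_word i = [Inv (Var (X i)), Inv (Var (Y i)), Pos (Var (X i)), Pos (Var (Y i))]"

definition conjugate_word :: "nat \<Rightarrow> gen letter list \<Rightarrow> sym letter list" where
  "conjugate_word j c = [Inv (Var (Z j))] @ map (map_letter Gen) c @ [Pos (Var (Z j))]"

text \<open>
  The left-hand side of the equation of genus \<open>g\<close> with \<open>m = length cs\<close> constants.
\<close>

definition quadratic_word :: "nat \<Rightarrow> gen letter list list \<Rightarrow> sym letter list" where
  "quadratic_word g cs =
    concat (map commutator_word [0..<g]) @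
    concat (map (\<lambda>j. conjugate_word j (cs ! j)) [0..<length cs])"

fun gen_val ::
  "'a::ab_group_add list \<Rightarrow> 'b::ab_group_add list \<Rightarrow> gen \<Rightarrow> 'b \<times> ('b \<Rightarrow> 'a)" where
  "gen_val as bs (GA k) = embed_A (as ! k)"
| "gen_val as bs (GB k) = embed_B (bs ! k)"

fun sym_val ::
  "'a::ab_group_add list \<Rightarrow> 'b::ab_group_add list \<Rightarrow> (var \<Rightarrow> 'b \<times> ('b \<Rightarrow> 'a)) \<Rightarrow>
    sym \<Rightarrow> 'b \<times> ('b \<Rightarrow> 'a)" where
  "sym_val as bs \<sigma> (Var v) = \<sigma> v"
| "sym_val as bs \<sigma> (Gen s) = gen_val as bs s"

fun letter_val :: "('s \<Rightarrow> 'b::ab_group_add \<times> ('b \<Rightarrow> 'a::ab_group_add)) \<Rightarrow> 's letter \<Rightarrow>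
    'b \<times> ('b \<Rightarrow> 'a)" where
  "letter_val v (Pos s) = v s"
| "letter_val v (Inv s) = inv\<^bsub>wreath\<^esub> (v s)"

definition word_val :: "('s \<Rightarrow> 'b::ab_group_add \<times> ('b \<Rightarrow> 'a::ab_group_add)) \<Rightarrow> 's letter list \<Rightarrow>
    'b \<times> ('b \<Rightarrow> 'a)" where
  "word_val v w = foldr (\<lambda>l u. letter_val v l \<otimes>\<^bsub>wreath\<^esub> u) w \<one>\<^bsub>wreath\<^esub>"

definition solvable ::
  "'a::ab_group_add list \<Rightarrow> 'b::ab_group_add list \<Rightarrow> sym letter list \<Rightarrow> bool" where
  "solvable as bs w \<longleftrightarrow>
    (\<exists>\<sigma>. (\<forall>v. \<sigma> v \<in> carrier wreath) \<and> word_val (sym_val as bs \<sigma>) w = \<one>\<^bsub>wreath\<^esub>)"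

text \<open>
  Letters are numbered injectively by positive integers, so that a word of length \<open>n\<close> becomes a
  machine input of length \<open>n\<close>.
\<close>

fun sym_code :: "sym \<Rightarrow> nat" where
  "sym_code (Var (X i)) = 5 * i"
| "sym_code (Var (Y i)) = 5 * i + 1"
| "sym_code (Var (Z i)) = 5 * i + 2"
| "sym_code (Gen (GA i)) = 5 * i + 3"
| "sym_code (Gen (GB i)) = 5 * i + 4"

fun letter_code :: "sym letter \<Rightarrow> int" where
  "letter_code (Pos s) = int (2 * sym_code s + 1)"
| "letter_code (Inv s) = int (2 * sym_code s + 2)"

lemma inj_letter_code: "inj letter_code"
proof -
  have sym: "s = t" if "sym_code s = sym_code t" for s t
    using that by (cases s rule: sym_code.cases; cases t rule: sym_code.cases; simp; presburger)
  have "l = l'" if "letter_code l = letter_code l'" for l l'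
    using that by (cases l; cases l'; simp; (use sym in presburger)?)
  then show ?thesis
    by (rule injI)
qed


subsection \<open>Random-access machines and polynomial time\<close>

text \<open>
  Registers \<open>r 0, r 1, \<dots>\<close> hold integers and are initially \<open>0\<close>; the input is a read-only array.
  Every instruction has unit cost.  Since addition and subtraction are the only arithmetic
  operations, the bit length of the register contents grows by at most one per step, so that
  polynomial time in this model agrees with polynomial time on Turing machines.
\<close>

datatype instr =
    Const nat int
  | Add nat nat nat
  | Sub nat nat nat
  | Load nat nat
  | Store nat nat
  | Input nat nat
  | JumpPos nat nat
  | Accept
  | Reject

type_synonym config = "nat \<times> (nat \<Rightarrow> int)"

text \<open>
  A negative address in \<open>Load\<close> or \<open>Store\<close> is read as \<open>0\<close>, and reading outside the input array
  yields \<open>0\<close>.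
\<close>

fun exec :: "int list \<Rightarrow> instr \<Rightarrow> config \<Rightarrow> config" where
  "exec inp (Const i c) (pc, r) = (pc + 1, r(i := c))"
| "exec inp (Add i j k) (pc, r) = (pc + 1, r(i := r j + r k))"
| "exec inp (Sub i j k) (pc, r) = (pc + 1, r(i := r j - r k))"
| "exec inp (Load i j) (pc, r) = (pc + 1, r(i := r (nat (r j))))"
| "exec inp (Store i j) (pc, r) = (pc + 1, r(nat (r i) := r j))"
| "exec inp (Input i j) (pc, r) =
    (pc + 1, r(i := if 0 \<le> r j \<and> r j < int (length inp) then inp ! nat (r j) else 0))"
| "exec inp (JumpPos i l) (pc, r) = (if r i > 0 then l else pc + 1, r)"
| "exec inp Accept (pc, r) = (pc, r)"
| "exec inp Reject (pc, r) = (pc, r)"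

text \<open>Outside the program the machine loops without halting.\<close>

definition step :: "instr list \<Rightarrow> int list \<Rightarrow> config \<Rightarrow> config" where
  "step P inp cfg = (if fst cfg < length P then exec inp (P ! fst cfg) cfg else cfg)"

definition run :: "instr list \<Rightarrow> int list \<Rightarrow> nat \<Rightarrow> config" where
  "run P inp t = (step P inp ^^ t) (0, \<lambda>_. 0)"

text \<open>
  Halting configurations are fixed points of \<open>step\<close>, so the following says that \<open>P\<close> halts after
  at most \<open>t\<close> steps, with answer \<open>b\<close>.
\<close>

definition answers_within :: "instr list \<Rightarrow> int list \<Rightarrow> nat \<Rightarrow> bool \<Rightarrow> bool" where
  "answers_within P inp t b \<longleftrightarrow>
    fst (run P inp t) < length P \<and> P ! fst (run P inp t) = (if b then Accept else Reject)"

text \<open>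
  The decision problem with set of instances \<open>I\<close>, encoded by \<open>enc\<close>, and yes-instances given by
  \<open>Q\<close>, is decidable in time polynomial in the length of the input.
\<close>

definition decidable_in_P :: "('i \<Rightarrow> int list) \<Rightarrow> 'i set \<Rightarrow> ('i \<Rightarrow> bool) \<Rightarrow> bool" where
  "decidable_in_P enc I Q \<longleftrightarrow>
    (\<exists>(P :: instr list) (p :: nat poly).
      \<forall>x\<in>I. answers_within P (enc x) (poly p (length (enc x))) (Q x))"

end

theory Submission
  imports
    Defs
    "HOL-Library.Groups_Big_Fun"
    "HOL-Library.Multiset"
    "HOL-Library.Product_Plus"
begin

text \<open>
  For \<open>x = (b, f)\<close> and \<open>y = (c, h)\<close> the commutator \<open>[x, y]\<close> is \<open>(0, f\<^sup>c - f + h - h\<^sup>b)\<close>.  If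
  \<open>2 g \<ge> rank B\<close>, the \<open>B\<close>-components of the \<open>2 g\<close> variables \<open>x\<^sub>i, y\<^sub>i\<close> can be chosen to generate \<open>B\<close>,
  and then the products of \<open>g\<close> commutators exhaust all finitely supported functions of total sum
  \<open>0\<close>, i.e. the whole kernel of the map from the wreath product to its abelianization \<open>A \<times> B\<close>.  Hence
  the equation is solvable iff the product of the constants vanishes in \<open>A \<times> B\<close>.

  Whether it does depends only on how often each generator letter occurs.  The count vectors of
  value \<open>0\<close> come from a fixed sublattice of \<open>\<int>\<^sup>N\<close>, and membership in it is decided by elimination
  along a triangular basis that is hard-wired into the program.  Since the counts are bounded by the
  length of the input, repeated subtraction suffices and the running time is linear.
\<close>

section \<open>The reduction to the abelianization\<close>

text \<open>In group ring terms: if the \<open>s i\<close> generate the group, then the elements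
  \<open>s i - 1\<close> generate the augmentation ideal. As \<open>F\<close> has total sum 0, it is
  the sum over its support of the pulse of height \<open>F y\<close> at \<open>y\<close> minus the
  same pulse at 0, and each such difference telescopes along an expression of \<open>y\<close> in
  the generators.\<close>

lemma sum_zero_in_augmentation_span:
  fixes s :: "nat \<Rightarrow> 'b::ab_group_add" and F :: "'b \<Rightarrow> 'a::ab_group_add"
  assumes gen: "group_closure (s ` {..<n}) = UNIV"
    and fin: "finite {x. F x \<noteq> 0}" and sum0: "Sum_any F = 0"
  shows "\<exists>p. (\<forall>i. finite {x. p i x \<noteq> 0}) \<and> F = (\<lambda>x. \<Sum>i<n. p i (s i + x) - p i x)"
proof -
  define D :: "('b \<Rightarrow> 'a) set" where
    "D = {F. \<exists>p. (\<forall>i. finite {x. p i x \<noteq> 0}) \<and> F = (\<lambda>x. \<Sum>i<n. p i (s i + x) - p i x)}"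
  define e :: "'b \<Rightarrow> 'a \<Rightarrow> 'b \<Rightarrow> 'a" where "e y a = (\<lambda>x. if x = y then a else 0)" for y a
  have fin_e: "finite {x. e y a x \<noteq> 0}" for y a
    by (rule finite_subset[of _ "{y}"]) (auto simp: e_def)
  have zero: "(\<lambda>_. 0) \<in> D"
    unfolding D_def by (intro CollectI exI[of _ "\<lambda>_ _. 0"]) simp
  have diff: "(\<lambda>x. F x - G x) \<in> D" if F: "F \<in> D" and G: "G \<in> D" for F G
  proof -
    obtain p where p: "\<And>i. finite {x. p i x \<noteq> 0}" "F = (\<lambda>x. \<Sum>i<n. p i (s i + x) - p i x)"
      using F unfolding D_def by blast
    obtain q where q: "\<And>i. finite {x. q i x \<noteq> 0}" "G = (\<lambda>x. \<Sum>i<n. q i (s i + x) - q i x)"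
      using G unfolding D_def by blast
    have "finite {x. p i x - q i x \<noteq> 0}" for i
      by (rule finite_subset[of _ "{x. p i x \<noteq> 0} \<union> {x. q i x \<noteq> 0}"]) (use p q in auto)
    then show ?thesis
      unfolding D_def using p(2) q(2)
      by (intro CollectI exI[of _ "\<lambda>i x. p i x - q i x"])
        (simp add: sum_subtractf[symmetric] algebra_simps)
  qed
  have add: "(\<lambda>x. F x + G x) \<in> D" if "F \<in> D" "G \<in> D" for F G
    using diff[OF that(1) diff[OF zero that(2)]] by simp
  have translate: "(\<lambda>x. F (y + x)) \<in> D" if F: "F \<in> D" for F y
  proof -
    obtain p where p: "\<And>i. finite {x. p i x \<noteq> 0}" "F = (\<lambda>x. \<Sum>i<n. p i (s i + x) - p i x)"
      using F unfolding D_def by blast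
    then show ?thesis
      unfolding D_def using finite_support_shift[OF p(1), of _ y]
      by (intro CollectI exI[of _ "\<lambda>i. shift (p i) y"]) (simp add: shift_def add.left_commute)
  qed
  have pulse: "(\<lambda>x. e (- y) a x - e 0 a x) \<in> D" for y a
  proof -
    have "y \<in> group_closure (s ` {..<n})"
      by (simp add: gen)
    then show ?thesis
    proof induction
      case (base y)
      then consider "y = 0" | j where "j < n" "y = s j"
        by auto
      then show ?case
      proof cases
        case 1
        then show ?thesis using zero by simp
      next
        case 2
        \<comment> \<open>One pulse in component \<open>j\<close> suffices, because
          \<open>e 0 a (s j + x) = e (- s j) a x\<close>.\<close>
        define p where "p i = (if i = j then e 0 a else (\<lambda>_. 0))" for i
        have "(\<Sum>i<n. p i (s i + x) - p i x) = (\<Sum>i<n. if i = j then e 0 a (s i + x) - e 0 a x else 0)"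
          for x
          by (rule sum.cong) (auto simp: p_def)
        then have "e (- y) a x - e 0 a x = (\<Sum>i<n. p i (s i + x) - p i x)" for x
          using 2 by (simp add: e_def eq_neg_iff_add_eq_0 add.commute)
        then show ?thesis
          unfolding D_def by (intro CollectI exI[of _ p]) (auto simp: fin_e p_def)
      qed
    next
      case (diff y z)
      \<comment> \<open>Translation moves the pulse at \<open>- y\<close> to
        \<open>- (y - z)\<close> and the pulse at \<open>- z\<close> to 0; the two translated pulses
        from 0 cancel.\<close>
      have eq: "e (- (y - z)) a x - e 0 a x =
          (e (- y) a (- z + x) - e 0 a (- z + x)) - (e (- z) a (- z + x) - e 0 a (- z + x))" for x
        by (auto simp: e_def algebra_simps)
      show ?case
        unfolding eq
        by (rule \<open>\<And>F G. F \<in> D \<Longrightarrow> G \<in> D \<Longrightarrow> (\<lambda>x. F x - G x) \<in> D\<close>)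
          (rule translate[OF diff.IH(1)] translate[OF diff.IH(2)])+
    qed
  qed
  define A where "A = {x. F x \<noteq> 0}"
  have "(\<lambda>x. \<Sum>y\<in>B. e y (F y) x - e 0 (F y) x) \<in> D" if "finite B" for B
    using that
  proof induction
    case empty
    then show ?case using zero by simp
  next
    case (insert y B)
    then show ?case
      using add[OF pulse[of "- y" "F y"] insert.IH] by simp
  qed
  then have "(\<lambda>x. \<Sum>y\<in>A. e y (F y) x - e 0 (F y) x) \<in> D"
    using fin A_def by simp
  moreover have "(\<Sum>y\<in>A. e y (F y) x - e 0 (F y) x) = F x" for x
  proof -
    have "(\<Sum>y\<in>A. e y (F y) x) = F x"
      using fin by (auto simp: e_def A_def)
    moreover have "(\<Sum>y\<in>A. e 0 (F y) x) = 0"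
      using sum0 by (cases "x = 0") (auto simp: e_def A_def Sum_any.expand_set)
    ultimately show ?thesis
      by (simp add: sum_subtractf)
  qed
  ultimately show ?thesis
    by (simp add: D_def)
qed

section \<open>Word values in the abelianization\<close>

definition abelianization :: "'b::ab_group_add \<times> ('b \<Rightarrow> 'a::ab_group_add) \<Rightarrow> 'a \<times> 'b" where
  "abelianization u = (Sum_any (snd u), fst u)"

interpretation wreath: group wreath
  by (rule group_wreath)

text \<open>A shift only permutes the arguments of a function, so it preserves the total
  sum.\<close>

lemma abelianization_mult:
  assumes "u \<in> carrier wreath" "v \<in> carrier wreath"
  shows "abelianization (u \<otimes>\<^bsub>wreath\<^esub> v) = abelianization u + abelianization v"
proof -
  obtain b f c h where uv: "u = (b, f)" "v = (c, h)"
      and fin: "finite {x. f x \<noteq> 0}" "finite {x. h x \<noteq> 0}"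
    using assms by (auto simp: wreath_def)
  have "Sum_any (\<lambda>x. shift f c x + h x) = Sum_any (shift f c) + Sum_any h"
    by (rule Sum_any.distrib[OF finite_support_shift[OF fin(1)] fin(2)])
  moreover have "Sum_any f = Sum_any (shift f c)"
    by (rule Sum_any.reindex_cong[of "(+) c"]) (auto simp: shift_def fun_eq_iff bij_plus)
  ultimately show ?thesis
    by (simp add: abelianization_def uv wreath_def)
qed

lemma abelianization_one [simp]: "abelianization \<one>\<^bsub>wreath\<^esub> = 0"
  by (simp add: abelianization_def wreath_def zero_prod_def)

lemma abelianization_inv:
  assumes "u \<in> carrier wreath"
  shows "abelianization (inv\<^bsub>wreath\<^esub> u) = - abelianization u"
proof -
  have "abelianization (inv\<^bsub>wreath\<^esub> u) + abelianization u = 0"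
    using assms by (simp add: abelianization_mult[symmetric])
  then show ?thesis
    by (simp add: eq_neg_iff_add_eq_0)
qed

lemma letter_val_closed: "(\<And>s. v s \<in> carrier wreath) \<Longrightarrow> letter_val v l \<in> carrier wreath"
  by (cases l) simp_all

lemma word_val_Nil [simp]: "word_val v [] = \<one>\<^bsub>wreath\<^esub>"
  and word_val_Cons [simp]: "word_val v (l # w) = letter_val v l \<otimes>\<^bsub>wreath\<^esub> word_val v w"
  by (simp_all add: word_val_def)

lemma word_val_cong:
  "(\<And>l. l \<in> set w \<Longrightarrow> letter_val v l = letter_val v' l) \<Longrightarrow> word_val v w = word_val v' w"
  by (induction w) simp_all

lemma word_val_closed: "(\<And>s. v s \<in> carrier wreath) \<Longrightarrow> word_val v w \<in> carrier wreath"
  by (induction w) (simp_all add: letter_val_closed)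

lemma word_val_append:
  assumes "\<And>s. v s \<in> carrier wreath"
  shows "word_val v (w @ w') = word_val v w \<otimes>\<^bsub>wreath\<^esub> word_val v w'"
  by (induction w) (simp_all add: assms letter_val_closed word_val_closed wreath.m_assoc)

lemma abelianization_word_val:
  assumes "\<And>s. v s \<in> carrier wreath"
  shows "abelianization (word_val v w) = sum_list (map (\<lambda>l. abelianization (letter_val v l)) w)"
  by (induction w) (simp_all add: assms letter_val_closed word_val_closed abelianization_mult)

lemma sym_val_closed:
  assumes "\<And>x. \<sigma> x \<in> carrier wreath"
  shows "sym_val as bs \<sigma> s \<in> carrier wreath"
proof (cases s)
  case (Gen k)
  have "finite {x. x = 0 \<and> Q}" for Q
    by (rule finite_subset[of _ "{0}"]) auto
  then show ?thesis
    using Gen by (cases k) (auto simp: embed_A_def embed_B_def wreath_def)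
qed (simp add: assms)

text \<open>Sending every variable to the identity makes the contribution of a letter independent of
  the assignment.\<close>

definition letter_total ::
  "'a::ab_group_add list \<Rightarrow> 'b::ab_group_add list \<Rightarrow> sym letter \<Rightarrow> 'a \<times> 'b" where
  "letter_total as bs = (\<lambda>l. abelianization (letter_val (sym_val as bs (\<lambda>_. \<one>\<^bsub>wreath\<^esub>)) l))"

text \<open>Every variable occurs once with each exponent in its commutator or conjugate, so it
  cancels in an abelian group and only the constants remain.\<close>

lemma abelianization_quadratic_word:
  assumes \<sigma>: "\<And>x. \<sigma> x \<in> carrier wreath"
  shows "abelianization (word_val (sym_val as bs \<sigma>) (quadratic_word g cs))
    = sum_list (map (letter_total as bs) (quadratic_word g cs))"
proof -
  let ?ab = "\<lambda>l. abelianization (letter_val (sym_val as bs \<sigma>) l)"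
  have comm: "sum_list (map ?ab (concat (map commutator_word xs)))
      = sum_list (map (letter_total as bs) (concat (map commutator_word xs)))" for xs
    by (induction xs) (simp_all add: commutator_word_def letter_total_def abelianization_inv \<sigma>)
  have const: "map (?ab \<circ> map_letter Gen) c = map (letter_total as bs \<circ> map_letter Gen) c" for c
  proof (rule map_cong[OF refl])
    fix l
    show "(?ab \<circ> map_letter Gen) l = (letter_total as bs \<circ> map_letter Gen) l"
      by (cases l) (simp_all add: letter_total_def)
  qed
  have conj: "sum_list (map ?ab (concat (map (\<lambda>j. conjugate_word j (cs ! j)) xs)))
      = sum_list (map (letter_total as bs) (concat (map (\<lambda>j. conjugate_word j (cs ! j)) xs)))" for xs
    by (induction xs)
      (simp_all add: conjugate_word_def const abelianization_inv \<sigma>, simp_all add: letter_total_def)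
  show ?thesis
    using comm[of "[0..<g]"] conj[of "[0..<length cs]"]
    by (simp add: abelianization_word_val sym_val_closed[OF \<sigma>] quadratic_word_def)
qed

section \<open>Commutators and the solvability criterion\<close>

text \<open>No inverse has to be computed: with \<open>u\<close> the claimed value of
  \<open>[x,y]\<close>, it suffices to check \<open>x y = y x u\<close>.\<close>

lemma commutator_wreath:
  assumes "(b, f) \<in> carrier wreath" "(c, h) \<in> carrier wreath"
  shows "inv\<^bsub>wreath\<^esub> (b, f) \<otimes>\<^bsub>wreath\<^esub> (inv\<^bsub>wreath\<^esub> (c, h) \<otimes>\<^bsub>wreath\<^esub> ((b, f) \<otimes>\<^bsub>wreath\<^esub> (c, h)))
    = (0, \<lambda>x. f (c + x) - f x + h x - h (b + x))" (is "_ = ?u")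
proof -
  have fin: "finite ({x. shift f c x \<noteq> 0} \<union> {x. f x \<noteq> 0} \<union> {x. h x \<noteq> 0} \<union> {x. shift h b x \<noteq> 0})"
    using assms by (simp add: wreath_def finite_support_shift)
  have "finite {x. f (c + x) - f x + h x - h (b + x) \<noteq> 0}"
    by (rule finite_subset[OF _ fin]) (auto simp: shift_def)
  then have u: "?u \<in> carrier wreath"
    by (simp add: wreath_def)
  have "(b, f) \<otimes>\<^bsub>wreath\<^esub> (c, h) = (c, h) \<otimes>\<^bsub>wreath\<^esub> ((b, f) \<otimes>\<^bsub>wreath\<^esub> ?u)"
    by (simp add: wreath_def shift_def fun_eq_iff ac_simps)
  then show ?thesis
    using assms u by (simp add: wreath.inv_solve_left' wreath.m_assoc)
qed

lemma word_val_commutators: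
  assumes \<sigma>: "\<And>x. \<sigma> x \<in> carrier wreath"
    and XY: "\<And>i. i < g \<Longrightarrow> \<sigma> (X i) = (b i, f i) \<and> \<sigma> (Y i) = (c i, h i)"
  shows "word_val (sym_val as bs \<sigma>) (concat (map commutator_word [0..<g]))
    = (0, \<lambda>x. \<Sum>i<g. f i (c i + x) - f i x + h i x - h i (b i + x))"
  using XY
proof (induction g)
  case 0
  then show ?case by (simp add: wreath_def)
next
  case (Suc g)
  have carrier: "(b g, f g) \<in> carrier wreath" "(c g, h g) \<in> carrier wreath"
    using \<sigma>[of "X g"] \<sigma>[of "Y g"] Suc.prems[of g] by simp_all
  have "word_val (sym_val as bs \<sigma>) (commutator_word g)
      = (0, \<lambda>x. f g (c g + x) - f g x + h g x - h g (b g + x))"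
    using Suc.prems[of g] commutator_wreath[OF carrier] carrier by (simp add: commutator_word_def)
  moreover have "word_val (sym_val as bs \<sigma>) (concat (map commutator_word [0..<g]))
    = (0, \<lambda>x. \<Sum>i<g. f i (c i + x) - f i x + h i x - h i (b i + x))"
    using Suc by simp
  ultimately show ?case
    by (simp add: word_val_append sym_val_closed[OF \<sigma>]) (simp add: wreath_def shift_def)
qed

lemma group_closure_mono:
  assumes "S \<subseteq> T"
  shows "group_closure S \<subseteq> group_closure T"
proof
  fix x assume "x \<in> group_closure S"
  then show "x \<in> group_closure T"
    by induction (use assms in \<open>auto intro: group_closure.intros\<close>)
qed

text \<open>The minimum defining the rank is attained because some finite set generates; a
  generating set of that size is padded with 0 to a sequence of length \<open>n\<close>.\<close>

lemma exists_generating_sequence: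
  assumes "finite S" "group_closure S = (UNIV :: 'b::ab_group_add set)"
    and "group_rank (UNIV :: 'b set) \<le> n"
  shows "\<exists>s :: nat \<Rightarrow> 'b. group_closure (s ` {..<n}) = UNIV"
proof -
  have "\<exists>S' :: 'b set. finite S' \<and> card S' = group_rank (UNIV :: 'b set) \<and> group_closure S' = UNIV"
    unfolding group_rank_def
    by (rule LeastI[of "\<lambda>m. \<exists>S'. finite S' \<and> card S' = m \<and> group_closure S' = (UNIV :: 'b set)"
          "card S"])
      (use assms in blast)
  then obtain S' :: "'b set" where S': "finite S'" "card S' \<le> n" "group_closure S' = UNIV"
    using assms(3) by auto
  obtain xs where xs: "set xs = S'" "distinct xs"
    using finite_distinct_list[OF S'(1)] by blast
  define s where "s i = (if i < length xs then xs ! i else 0)" for i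
  have "length xs \<le> n"
    using S'(2) xs distinct_card by fastforce
  then have "S' \<subseteq> s ` {..<n}"
    using xs(1) by (fastforce simp: s_def in_set_conv_nth)
  then have "group_closure (s ` {..<n}) = UNIV"
    using S'(3) group_closure_mono by blast
  then show ?thesis
    by blast
qed

text \<open>Necessity: the abelianized left-hand side does not depend on the assignment.
  Sufficiency: with trivial \<open>Z j\<close> the constants multiply to \<open>(0, F)\<close> with
  \<open>F\<close> of total sum 0, and the commutators can be made to produce
  \<open>(0, - F)\<close>.\<close>

lemma solvable_quadratic_word_iff:
  fixes as :: "'a::ab_group_add list" and bs :: "'b::ab_group_add list"
  assumes bs: "group_closure (set bs) = UNIV" and g: "group_rank (UNIV :: 'b set) \<le> 2 * g"
  shows "solvable as bs (quadratic_word g cs)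
    \<longleftrightarrow> sum_list (map (letter_total as bs) (quadratic_word g cs)) = 0"
proof
  assume "solvable as bs (quadratic_word g cs)"
  then show "sum_list (map (letter_total as bs) (quadratic_word g cs)) = 0"
    unfolding solvable_def by (metis abelianization_quadratic_word abelianization_one)
next
  assume sum0: "sum_list (map (letter_total as bs) (quadratic_word g cs)) = 0"
  define conj where "conj = concat (map (\<lambda>j. conjugate_word j (cs ! j)) [0..<length cs])"
  let ?val = "\<lambda>\<sigma>. word_val (sym_val as bs \<sigma>)"
  define \<sigma>1 :: "var \<Rightarrow> 'b \<times> ('b \<Rightarrow> 'a)" where "\<sigma>1 = (\<lambda>_. \<one>\<^bsub>wreath\<^esub>)"
  have \<sigma>1: "\<sigma>1 x \<in> carrier wreath" for x
    unfolding \<sigma>1_def by simp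
  have closed: "?val \<sigma>1 conj \<in> carrier wreath"
    by (rule word_val_closed[OF sym_val_closed[OF \<sigma>1]])
  obtain \<delta> F where F: "?val \<sigma>1 conj = (\<delta>, F)"
    by (cases "?val \<sigma>1 conj")
  have finF: "finite {x. F x \<noteq> 0}"
    using closed F by (simp add: wreath_def)
  have "?val \<sigma>1 (concat (map commutator_word [0..<g])) = \<one>\<^bsub>wreath\<^esub>"
    using word_val_commutators[OF \<sigma>1, where b = "\<lambda>_. 0" and f = "\<lambda>_ _. 0"
        and c = "\<lambda>_. 0" and h = "\<lambda>_ _. 0"]
    by (simp add: \<sigma>1_def wreath_def)
  then have "abelianization (?val \<sigma>1 conj) = abelianization (?val \<sigma>1 (quadratic_word g cs))"
    using closed
    by (simp add: quadratic_word_def conj_def word_val_append sym_val_closed[OF \<sigma>1])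
  then have "abelianization (\<delta>, F) = 0"
    using sum0 by (simp add: abelianization_quadratic_word[OF \<sigma>1] F)
  then have \<delta>: "\<delta> = 0" and F0: "Sum_any F = 0"
    by (simp_all add: abelianization_def zero_prod_def)
  obtain s :: "nat \<Rightarrow> 'b" where s: "group_closure (s ` {..<2 * g}) = UNIV"
    using exists_generating_sequence[OF _ bs g] by auto
  obtain p where p: "\<And>i. finite {x. p i x \<noteq> 0}" "F = (\<lambda>x. \<Sum>i<2 * g. p i (s i + x) - p i x)"
    using sum_zero_in_augmentation_span[OF s finF F0] by blast
  \<comment> \<open>In \<open>[X i, Y i]\<close> the function of each variable is differenced along
    the \<open>B\<close>-component of the other one, hence the crossed indices. The two differences
    enter with opposite signs, which the minus sign at \<open>X i\<close> evens out.\<close>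
  define \<sigma> where "\<sigma> v = (case v of X i \<Rightarrow> (s (2 * i), \<lambda>x. - p (2 * i + 1) x)
    | Y i \<Rightarrow> (s (2 * i + 1), p (2 * i)) | Z i \<Rightarrow> \<one>\<^bsub>wreath\<^esub>)" for v
  have \<sigma>: "\<sigma> v \<in> carrier wreath" for v
    by (cases v) (use p(1) in \<open>simp_all add: \<sigma>_def\<close>, simp_all add: wreath_def)
  have "?val \<sigma> (concat (map commutator_word [0..<g]))
    = (0, \<lambda>x. \<Sum>i<g. - p (2 * i + 1) (s (2 * i + 1) + x) - - p (2 * i + 1) x
        + p (2 * i) x - p (2 * i) (s (2 * i) + x))"
    by (rule word_val_commutators[OF \<sigma>]) (simp add: \<sigma>_def)
  moreover have "(\<Sum>i<g. - p (2 * i + 1) (s (2 * i + 1) + x) - - p (2 * i + 1) x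
        + p (2 * i) x - p (2 * i) (s (2 * i) + x)) = - (\<Sum>i<2 * g. p i (s i + x) - p i x)" for x
    by (induction g) (simp_all add: algebra_simps)
  ultimately have "?val \<sigma> (concat (map commutator_word [0..<g])) = (0, \<lambda>x. - F x)"
    by (simp add: p(2))
  moreover have "?val \<sigma> conj = ?val \<sigma>1 conj"
  proof (rule word_val_cong)
    fix l assume "l \<in> set conj"
    then consider j where "l = Pos (Var (Z j)) \<or> l = Inv (Var (Z j))"
      | l' where "l = map_letter Gen l'"
      by (auto simp: conj_def conjugate_word_def)
    then show "letter_val (sym_val as bs \<sigma>) l = letter_val (sym_val as bs \<sigma>1) l"
    proof cases
      case 1
      then show ?thesis by (auto simp: \<sigma>_def \<sigma>1_def)
    next
      case 2
      then show ?thesis by (cases l') simp_all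
    qed
  qed
  ultimately have "?val \<sigma> (quadratic_word g cs) = (0, \<lambda>x. - F x) \<otimes>\<^bsub>wreath\<^esub> (0, F)"
    by (simp add: quadratic_word_def word_val_append sym_val_closed[OF \<sigma>] F \<delta> flip: conj_def)
  also have "\<dots> = \<one>\<^bsub>wreath\<^esub>"
    by (simp add: wreath_def shift_def)
  finally show "solvable as bs (quadratic_word g cs)"
    unfolding solvable_def using \<sigma> by blast
qed

section \<open>The random-access machine\<close>

text \<open>Starting from an arbitrary configuration and asking only for an upper bound on the time
  allows programs to be verified backwards from their halting instructions.\<close>

definition halts :: "instr list \<Rightarrow> int list \<Rightarrow> bool \<Rightarrow> nat \<Rightarrow> config \<Rightarrow> bool" where
  "halts P inp b T cfg \<longleftrightarrow>
    (\<exists>t\<le>T. fst ((step P inp ^^ t) cfg) < length P \<and>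
      P ! fst ((step P inp ^^ t) cfg) = (if b then Accept else Reject))"

lemma halts_mono: "halts P inp b T cfg \<Longrightarrow> T \<le> T' \<Longrightarrow> halts P inp b T' cfg"
  unfolding halts_def by (meson order_trans)

text \<open>The rule of symbolic execution, charging one step per use. Only the code from address
  \<open>s\<close> on has to be known, so a block can be verified wherever it is placed.\<close>

lemma halts_exec:
  assumes "pc = s + i" "drop s P = C" "i < length C" "C ! i = I"
    and "halts P inp b T (exec inp I (pc, r))"
  shows "halts P inp b (Suc T) (pc, r)"
proof -
  have "s + i < length P" "P ! (s + i) = I"
    using assms(2-4) by (auto simp: nth_drop)
  then have "step P inp (pc, r) = exec inp I (pc, r)"
    by (simp add: step_def assms(1))
  with assms(5) obtain t where "t \<le> T"
    "fst ((step P inp ^^ Suc t) (pc, r)) < length P \<and>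
     P ! fst ((step P inp ^^ Suc t) (pc, r)) = (if b then Accept else Reject)"
    unfolding halts_def by (metis comp_apply funpow_Suc_right)
  then show ?thesis
    unfolding halts_def by (meson Suc_le_mono)
qed

lemma halts_now:
  assumes "pc = s + i" "drop s P = C" "i < length C" "C ! i = (if b then Accept else Reject)"
  shows "halts P inp b T (pc, r)"
proof -
  have "s + i < length P" "P ! (s + i) = C ! i"
    using assms(2,3) by (auto simp: nth_drop)
  then show ?thesis
    unfolding halts_def using assms(1,4) by (intro exI[of _ 0]) simp
qed

text \<open>\<open>Accept\<close> and \<open>Reject\<close> leave the configuration fixed, so an
  early answer still stands at time \<open>T\<close>.\<close>

lemma halts_imp_answers_within:
  assumes "halts P inp b T (0, \<lambda>_. 0)"
  shows "answers_within P inp T b"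
proof -
  obtain t where t: "t \<le> T" "fst (run P inp t) < length P"
      "P ! fst (run P inp t) = (if b then Accept else Reject)"
    using assms by (auto simp: halts_def run_def)
  have fixpoint: "step P inp (run P inp t) = run P inp t"
    using t(2,3) by (cases "run P inp t") (auto simp: step_def)
  have "(step P inp ^^ k) (run P inp t) = run P inp t" for k
    by (induction k) (simp_all add: fixpoint)
  moreover have "run P inp T = (step P inp ^^ (T - t)) (run P inp t)"
    using t(1) unfolding run_def by (metis comp_apply funpow_add le_add_diff_inverse2)
  ultimately show ?thesis
    using t by (simp add: answers_within_def)
qed

section \<open>Operations on a vector held in registers\<close>

text \<open>
  Registers \<open>0\<close> to \<open>3\<close> are scratch; coordinate \<open>i\<close> of the vector under test is in register \<open>i + 4\<close>.
\<close>

fun add_vec :: "(nat \<Rightarrow> int) \<Rightarrow> nat \<Rightarrow> instr list" where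
  "add_vec a 0 = []"
| "add_vec a (Suc n) = add_vec a n @ [Const 1 (a n), Add (n + 4) (n + 4) 1]"

lemma length_add_vec [simp]: "length (add_vec a n) = 2 * n"
  by (induction n) simp_all

lemma drop_append_eq: "drop s P = C @ D \<Longrightarrow> drop (s + length C) P = D"
  by (metis append_eq_conv_conj drop_drop add.commute)

text \<open>Blocks are specified in continuation style: whatever state the block leaves behind must
  halt within \<open>T\<close>, and the cost of the block is added. The scratch registers of
  \<open>r'\<close> are left unspecified.\<close>

lemma halts_add_vec:
  assumes "drop s P = add_vec a n @ D"
    and "\<And>r'. (\<And>i. i < n \<Longrightarrow> r' (i + 4) = r (i + 4) + a i) \<Longrightarrow>
      (\<And>i. n \<le> i \<Longrightarrow> r' (i + 4) = r (i + 4)) \<Longrightarrow> halts P inp b T (s + 2 * n, r')"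
  shows "halts P inp b (T + 2 * n) (s, r)"
  using assms
proof (induction n arbitrary: T D)
  case 0
  then show ?case by simp
next
  case (Suc n)
  let ?D = "[Const 1 (a n), Add (n + 4) (n + 4) 1] @ D"
  have code: "drop s P = add_vec a n @ ?D"
    using Suc.prems(1) by simp
  have D: "drop (s + 2 * n) P = ?D"
    using drop_append_eq[OF code] by simp
  have "halts P inp b (Suc (Suc T) + 2 * n) (s, r)"
  proof (rule Suc.IH[OF code])
    fix r' assume r': "\<And>i. i < n \<Longrightarrow> r' (i + 4) = r (i + 4) + a i"
      "\<And>i. n \<le> i \<Longrightarrow> r' (i + 4) = r (i + 4)"
    show "halts P inp b (Suc (Suc T)) (s + 2 * n, r')"
      apply (rule halts_exec[OF _ D, of _ 0], simp, simp, simp)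
      apply simp
      apply (rule halts_exec[OF _ D, of _ 1], simp, simp, simp)
      apply simp
      apply (rule Suc.prems(2)[simplified])
      using r' by (auto simp: less_Suc_eq)
  qed
  then show ?case by simp
qed

text \<open>\<open>JumpPos\<close> only recognizes positive values, so both \<open>- R\<close> and
  \<open>R\<close> are tested; the last jump is unconditional and skips \<open>Reject\<close>. Jump
  targets are absolute, hence the parameter \<open>s\<close>.\<close>

definition zero_test :: "nat \<Rightarrow> nat \<Rightarrow> instr list" where
  "zero_test R s = [Const 1 0, Sub 0 1 R, JumpPos 0 (s + 6), JumpPos R (s + 6),
    Const 1 1, JumpPos 1 (s + 7), Reject]"

lemma halts_zero_test:
  assumes "drop s P = zero_test R s @ D" and "R \<ge> 4"
    and "\<And>r'. r R = 0 \<Longrightarrow> (\<And>i. r' (i + 4) = r (i + 4)) \<Longrightarrow> halts P inp b T (s + 7, r')"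
  shows "halts P inp (r R = 0 \<and> b) (T + 6) (s, r)"
proof -
  note D = assms(1)[unfolded zero_test_def]
  have "halts P inp (r R = 0 \<and> b) (Suc (Suc (Suc (Suc (Suc (Suc T)))))) (s, r)"
    using \<open>R \<ge> 4\<close>
    apply -
    apply (rule halts_exec[OF _ D, of _ 0], simp, simp, simp)
    apply simp
    apply (rule halts_exec[OF _ D, of _ 1], simp, simp, simp)
    apply simp
    apply (rule halts_exec[OF _ D, of _ 2], simp, simp, simp)
    apply (simp, intro conjI impI)
     apply (rule halts_now[OF _ D, of _ 6], simp, simp, simp)
    apply (rule halts_exec[OF _ D, of _ 3], simp, simp, simp)
    apply (simp, intro conjI impI)
     apply (rule halts_now[OF _ D, of _ 6], simp, simp, simp)
    apply (rule halts_exec[OF _ D, of _ 4], simp, simp, simp)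
    apply simp
    apply (rule halts_exec[OF _ D, of _ 5], simp, simp, simp)
    apply simp
    apply (rule assms(3))
    by auto
  then show ?thesis
    by (simp add: numeral_eq_Suc)
qed

text \<open>
  The code at address \<open>s\<close> adds or subtracts \<open>a\<close> until coordinate \<open>n\<close> is smaller than \<open>a n\<close> in absolute
  value, and then falls through to what follows it.
\<close>

definition reduce :: "(nat \<Rightarrow> int) \<Rightarrow> nat \<Rightarrow> nat \<Rightarrow> instr list" where
  "reduce a n s =
    [Const 1 (a n - 1), Sub 0 (n + 4) 1, JumpPos 0 (s + 8),
     Const 1 (1 - a n), Sub 0 1 (n + 4), JumpPos 0 (s + 12 + 2 * n),
     Const 1 1, JumpPos 1 (s + 16 + 4 * n)]
    @ add_vec (\<lambda>i. - 1 * a i) (Suc n) @ [Const 1 1, JumpPos 1 s]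
    @ add_vec a (Suc n) @ [Const 1 1, JumpPos 1 s]"

lemma length_reduce: "length (reduce a n s) = 16 + 4 * n"
  by (simp add: reduce_def)

lemma abs_add_mult_le: "\<bar>k\<bar> = 1 \<Longrightarrow> nat \<bar>x + k * y\<bar> \<le> nat \<bar>x\<bar> + nat \<bar>y\<bar>" for x y :: int
  by (cases "k \<ge> 0") auto

text \<open>
  The weight of coordinate \<open>n\<close> pays for one iteration together with the growth that it causes in the
  weighted lower coordinates, so the weighted sum is a potential function for the loop.
\<close>

lemma halts_reduce:
  fixes a :: "nat \<Rightarrow> int" and w :: "nat \<Rightarrow> nat"
  assumes code: "drop s P = reduce a n s @ D" and "a n > 0"
    and exit: "\<And>r'. \<bar>r' (n + 4)\<bar> < a n \<Longrightarrow> I (\<lambda>i. r' (i + 4)) \<Longrightarrow>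
      halts P inp b (K + (\<Sum>i<n. w i * nat \<bar>r' (i + 4)\<bar>)) (s + 16 + 4 * n, r')"
    and inv: "\<And>v v' k. \<bar>k\<bar> = 1 \<Longrightarrow> I v \<Longrightarrow> (\<And>i. i \<le> n \<Longrightarrow> v' i = v i + k * a i) \<Longrightarrow> I v'"
    and cong: "\<And>v v'. I v \<Longrightarrow> (\<And>i. i \<le> n \<Longrightarrow> v' i = v i) \<Longrightarrow> I v'"
    and "I (\<lambda>i. r (i + 4))"
  shows "halts P inp b (K + 8 + (\<Sum>i<n. w i * nat \<bar>r (i + 4)\<bar>)
    + (2 * n + 10 + (\<Sum>i<n. w i * nat \<bar>a i\<bar>)) * nat \<bar>r (n + 4)\<bar>) (s, r)"
  using \<open>I (\<lambda>i. r (i + 4))\<close>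
proof (induction "nat \<bar>r (n + 4)\<bar>" arbitrary: r rule: less_induct)
  case less
  note D = code[unfolded reduce_def append.assoc]
  \<comment> \<open>The 8 pays for the exit path. One iteration costs at most
    \<open>2 * n + 10\<close>: six test instructions, \<open>2 * n + 2\<close> to add the vector,
    and two to jump back.\<close>
  define T where "T r = K + 8 + (\<Sum>i<n. w i * nat \<bar>r (i + 4)\<bar>)
    + (2 * n + 10 + (\<Sum>i<n. w i * nat \<bar>a i\<bar>)) * nat \<bar>r (n + 4)\<bar>" for r :: "nat \<Rightarrow> int"
  \<comment> \<open>Eight test instructions precede the subtracting block; that block and its jump
    back have length \<open>2 * n + 4\<close>, so the adding block starts at
    \<open>s + 12 + 2 * n\<close>.\<close>
  have drop1: "drop (s + 8) P = add_vec (\<lambda>i. - 1 * a i) (Suc n) @ [Const 1 1, JumpPos 1 s]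
      @ add_vec a (Suc n) @ [Const 1 1, JumpPos 1 s] @ D"
    using drop_append_eq[OF D] by (simp add: numeral_eq_Suc)
  have drop2: "drop (s + 10 + 2 * n) P = [Const 1 1, JumpPos 1 s]
      @ add_vec a (Suc n) @ [Const 1 1, JumpPos 1 s] @ D"
    using drop_append_eq[OF drop1] by (simp add: algebra_simps)
  have drop3: "drop (s + 12 + 2 * n) P = add_vec a (Suc n) @ [Const 1 1, JumpPos 1 s] @ D"
    using drop_append_eq[OF drop2] by (simp add: algebra_simps)
  \<comment> \<open>Both directions at once: \<open>k = - 1\<close> for the subtracting block, whose
    entries are written \<open>- 1 * a i\<close> to fit, and \<open>k = 1\<close> for the adding
    one.\<close>
  have iterate: "halts P inp b (T r - 6) (s', r1)" "T r \<ge> 6"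
    if s': "drop s' P = add_vec (\<lambda>i. k * a i) (Suc n) @ [Const 1 1, JumpPos 1 s] @ D'"
      and k: "\<bar>k\<bar> = 1" and r1: "\<And>i. r1 (i + 4) = r (i + 4)"
      and less': "\<bar>r (n + 4) + k * a n\<bar> < \<bar>r (n + 4)\<bar>" for s' D' r1 k
  proof -
    have T_less: "T r' + (2 * n + 10) \<le> T r"
      if r': "\<And>i. i \<le> n \<Longrightarrow> r' (i + 4) = r (i + 4) + k * a i" for r'
    proof -
      have "(\<Sum>i<n. w i * nat \<bar>r' (i + 4)\<bar>) \<le> (\<Sum>i<n. w i * (nat \<bar>r (i + 4)\<bar> + nat \<bar>a i\<bar>))"
        using abs_add_mult_le[OF k] r' by (intro sum_mono mult_left_mono) auto
      also have "\<dots> = (\<Sum>i<n. w i * nat \<bar>r (i + 4)\<bar>) + (\<Sum>i<n. w i * nat \<bar>a i\<bar>)"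
        by (simp add: algebra_simps sum.distrib)
      finally have 1: "(\<Sum>i<n. w i * nat \<bar>r' (i + 4)\<bar>) \<le> \<dots>" .
      let ?W = "2 * n + 10 + (\<Sum>i<n. w i * nat \<bar>a i\<bar>)"
      have "Suc (nat \<bar>r' (n + 4)\<bar>) \<le> nat \<bar>r (n + 4)\<bar>"
        using less' r'[of n] by simp
      then have "?W * Suc (nat \<bar>r' (n + 4)\<bar>) \<le> ?W * nat \<bar>r (n + 4)\<bar>"
        by (rule mult_le_mono2)
      with 1 show ?thesis
        unfolding T_def mult_Suc_right by linarith
    qed
    \<comment> \<open>Applying \<open>T_less\<close> to some updated state shows that the truncated
      subtractions from \<open>T r\<close> are exact.\<close>
    have *: "2 * n + 10 \<le> T r"
      using T_less[of "\<lambda>i. r i + k * a (i - 4)"] by simp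
    then show "T r \<ge> 6"
      by simp
    have "halts P inp b (T r - (2 * n + 10) + 2 + 2 * Suc n) (s', r1)"
    proof (rule halts_add_vec[OF s'])
      fix r' assume "\<And>i. i < Suc n \<Longrightarrow> r' (i + 4) = r1 (i + 4) + k * a i"
      then have r': "\<And>i. i \<le> n \<Longrightarrow> r' (i + 4) = r (i + 4) + k * a i"
        by (simp add: r1)
      have "I (\<lambda>i. r' (i + 4))"
        using inv[OF k less.prems] r' by simp
      then have "I (\<lambda>i. (r'(1 := 1)) (i + 4))"
        using cong by simp
      then have "halts P inp b (T (r'(1 := 1))) (s, r'(1 := 1))"
        unfolding T_def using less' r' by (intro less.hyps) auto
      then have "halts P inp b (T r') (s, r'(1 := 1))"
        by (simp add: T_def)
      then have "halts P inp b (T r - (2 * n + 10)) (s, r'(1 := 1))"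
        by (rule halts_mono) (use T_less[OF r'] in simp)
      moreover note jump = drop_append_eq[OF s', simplified]
      ultimately have "halts P inp b (Suc (Suc (T r - (2 * n + 10)))) (s' + (2 + 2 * n), r')"
        apply -
        apply (rule halts_exec[OF _ jump, of _ 0], simp, simp, simp, simp)
        apply (rule halts_exec[OF _ jump, of _ 1], simp, simp, simp, simp)
        done
      then show "halts P inp b (T r - (2 * n + 10) + 2) (s' + 2 * Suc n, r')"
        by simp
    qed
    then show "halts P inp b (T r - 6) (s', r1)"
      by (rule halts_mono) (use * in simp)
  qed
  consider (pos) "r (n + 4) \<ge> a n" | (neg) "r (n + 4) \<le> - a n" | (small) "\<bar>r (n + 4)\<bar> < a n"
    by linarith
  then have "halts P inp b (T r) (s, r)"
  proof cases
    case pos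
    \<comment> \<open>\<open>r1\<close> is the state after the first test. Its constant is
      \<open>a n - 1\<close> because the jump requires a strictly positive difference.\<close>
    define r1 where "r1 = r(1 := a n - 1, 0 := r (n + 4) - (a n - 1))"
    have "halts P inp b (T r - 6) (s + 8, r1)" "T r \<ge> 6"
      using iterate[of "s + 8" "- 1" _ r1] drop1 pos \<open>a n > 0\<close> by (simp_all add: r1_def)
    then have "halts P inp b (Suc (Suc (Suc (T r - 6)))) (s, r)"
      using pos
      apply -
      apply (rule halts_exec[OF _ D, of _ 0], simp, simp, simp, simp)
      apply (rule halts_exec[OF _ D, of _ 1], simp, simp, simp, simp)
      apply (rule halts_exec[OF _ D, of _ 2], simp, simp, simp)
      by (simp add: r1_def fun_upd_twist)
    then show ?thesis
      by (rule halts_mono) (use \<open>T r \<ge> 6\<close> in simp)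
  next
    case neg
    define r1 where "r1 = r(1 := 1 - a n, 0 := 1 - a n - r (n + 4))"
    have "halts P inp b (T r - 6) (s + 12 + 2 * n, r1)" "T r \<ge> 6"
      using iterate[of "s + 12 + 2 * n" 1 _ r1] drop3 neg \<open>a n > 0\<close> by (simp_all add: r1_def)
    then have "halts P inp b (Suc (Suc (Suc (Suc (Suc (Suc (T r - 6))))))) (s, r)"
      using neg \<open>a n > 0\<close>
      apply -
      apply (rule halts_exec[OF _ D, of _ 0], simp, simp, simp, simp)
      apply (rule halts_exec[OF _ D, of _ 1], simp, simp, simp, simp)
      apply (rule halts_exec[OF _ D, of _ 2], simp, simp, simp, simp)
      apply (rule halts_exec[OF _ D, of _ 3], simp, simp, simp, simp)
      apply (rule halts_exec[OF _ D, of _ 4], simp, simp, simp, simp)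
      apply (rule halts_exec[OF _ D, of _ 5], simp, simp, simp)
      by (simp add: r1_def fun_upd_twist)
    then show ?thesis
      by (rule halts_mono) (use \<open>T r \<ge> 6\<close> in simp)
  next
    case small
    define r1 where "r1 = r(0 := 1 - a n - r (n + 4), 1 := 1)"
    have "I (\<lambda>i. r1 (i + 4))"
      using cong[OF less.prems] by (simp add: r1_def)
    then have "halts P inp b (K + (\<Sum>i<n. w i * nat \<bar>r1 (i + 4)\<bar>)) (s + 16 + 4 * n, r1)"
      using small by (intro exit) (simp_all add: r1_def)
    moreover define T' where "T' = K + (\<Sum>i<n. w i * nat \<bar>r (i + 4)\<bar>)"
    moreover have "\<not> a n - 1 < r (n + 4)" "\<not> r (n + 4) < 1 - a n"
      using small by simp_all
    ultimately have "halts P inp b (Suc (Suc (Suc (Suc (Suc (Suc (Suc (Suc T')))))))) (s, r)"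
      apply -
      apply (rule halts_exec[OF _ D, of _ 0], simp, simp, simp, simp)
      apply (rule halts_exec[OF _ D, of _ 1], simp, simp, simp, simp)
      apply (rule halts_exec[OF _ D, of _ 2], simp, simp, simp, simp)
      apply (rule halts_exec[OF _ D, of _ 3], simp, simp, simp, simp)
      apply (rule halts_exec[OF _ D, of _ 4], simp, simp, simp, simp)
      apply (rule halts_exec[OF _ D, of _ 5], simp, simp, simp, simp)
      apply (rule halts_exec[OF _ D, of _ 6], simp, simp, simp, simp)
      apply (rule halts_exec[OF _ D, of _ 7], simp, simp, simp)
      by (simp add: r1_def T'_def fun_upd_twist)
    then show ?thesis
      by (rule halts_mono) (simp add: T_def T'_def)
  qed
  then show ?case
    by (simp add: T_def)
qed


section \<open>Deciding membership in a lattice\<close>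

text \<open>
  Among the vectors of \<open>L\<close> supported on \<open>{0..n}\<close>, one with least positive coordinate \<open>n\<close> clears that
  coordinate from every other such vector, which leaves a vector of \<open>L\<close> supported on \<open>{0..<n}\<close>.
\<close>

lemma exists_lattice_test:
  fixes L :: "(nat \<Rightarrow> int) set"
  assumes zero: "(\<lambda>_. 0) \<in> L"
    and diff: "\<And>u v. u \<in> L \<Longrightarrow> v \<in> L \<Longrightarrow> (\<lambda>i. u i - v i) \<in> L"
  shows "\<exists>C K w. \<forall>P inp r. drop s P = C \<longrightarrow>
    halts P inp ((\<lambda>i. if i < n then r (i + 4) else 0) \<in> L)
      (K + (\<Sum>i<n. w i * nat \<bar>r (i + 4)\<bar>)) (s, r)"
proof (induction n arbitrary: s)
  case 0
  have "halts P inp ((\<lambda>i. if i < 0 then r (i + 4) else 0) \<in> L)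
      (0 + (\<Sum>i<0. 0 * nat \<bar>r (i + 4)\<bar>)) (s, r)" if "drop s P = [Accept]" for P inp r
    using zero by (intro halts_now[OF _ that, of s 0]) simp_all
  then show ?case
    by (intro exI[of _ "[Accept]"] exI[of _ 0] exI[of _ "\<lambda>_. 0"]) simp
next
  case (Suc n)
  define V where "V n r = (\<lambda>i. if i < n then r i else 0)" for n :: nat and r :: "nat \<Rightarrow> int"
  have neg: "(\<lambda>i. - u i) \<in> L" if "u \<in> L" for u
    using diff[OF zero that] by simp
  have add: "(\<lambda>i. u i + v i) \<in> L" if "u \<in> L" "v \<in> L" for u v
    using diff[OF that(1) neg[OF that(2)]] by simp
  have V_Suc: "V (Suc n) r = V n r" if "r n = 0" for r
    using that by (auto simp: V_def fun_eq_iff less_Suc_eq)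
  define S where "S = {a \<in> L. a n > 0 \<and> (\<forall>i>n. a i = 0)}"
  show ?case
  proof (cases "S = {}")
    case True
    \<comment> \<open>The code for the lower coordinates starts behind the seven instructions of the
      zero test; as jumps are absolute, the induction is over all addresses.\<close>
    obtain C K w where IH: "\<And>P inp r. drop (s + 7) P = C \<Longrightarrow>
        halts P inp (V n (\<lambda>i. r (i + 4)) \<in> L) (K + (\<Sum>i<n. w i * nat \<bar>r (i + 4)\<bar>)) (s + 7, r)"
      using Suc.IH[of "s + 7"] unfolding V_def by blast
    \<comment> \<open>If coordinate \<open>n\<close> were nonzero, the vector or its negative would
      lie in the empty set \<open>S\<close>.\<close>
    have in_L: "V (Suc n) r \<in> L \<longleftrightarrow> r n = 0 \<and> V n r \<in> L" for r
    proof (cases "r n = 0")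
      case False
      have "V (Suc n) r \<notin> L"
      proof
        assume V: "V (Suc n) r \<in> L"
        then have "V (Suc n) r \<in> S \<or> (\<lambda>i. - V (Suc n) r i) \<in> S"
          using False neg[OF V] unfolding S_def by (auto simp: V_def)
        with True show False by simp
      qed
      with False show ?thesis by simp
    qed (simp add: V_Suc)
    have "halts P inp (V (Suc n) (\<lambda>i. r (i + 4)) \<in> L)
        (K + 6 + (\<Sum>i<Suc n. w i * nat \<bar>r (i + 4)\<bar>)) (s, r)"
      if code: "drop s P = zero_test (n + 4) s @ C" for P inp r
    proof -
      have C: "drop (s + 7) P = C"
        using drop_append_eq[OF code] by (simp add: zero_test_def numeral_eq_Suc)
      have "halts P inp (r (n + 4) = 0 \<and> V n (\<lambda>i. r (i + 4)) \<in> L)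
          (K + (\<Sum>i<n. w i * nat \<bar>r (i + 4)\<bar>) + 6) (s, r)"
      proof (rule halts_zero_test[OF code])
        fix r' :: "nat \<Rightarrow> int" assume "\<And>i. r' (i + 4) = r (i + 4)"
        then show "halts P inp (V n (\<lambda>i. r (i + 4)) \<in> L)
            (K + (\<Sum>i<n. w i * nat \<bar>r (i + 4)\<bar>)) (s + 7, r')"
          using IH[OF C, of inp r'] by simp
      qed simp
      then show ?thesis
        unfolding in_L by (rule halts_mono) simp
    qed
    then show ?thesis
      unfolding V_def by blast
  next
    case False
    then obtain a where a: "a \<in> S" and min: "\<And>u. u \<in> S \<Longrightarrow> nat (a n) \<le> nat (u n)"
      using ex_has_least_nat[of "\<lambda>u. u \<in> S" _ "\<lambda>u. nat (u n)"] by blast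
    from a have aL: "a \<in> L" and an: "a n > 0" and a0: "\<And>i. i > n \<Longrightarrow> a i = 0"
      by (auto simp: S_def)
    define s' where "s' = s + 16 + 4 * n"
    obtain C K w where IH: "\<And>P inp r. drop (s' + 7) P = C \<Longrightarrow>
        halts P inp (V n (\<lambda>i. r (i + 4)) \<in> L) (K + (\<Sum>i<n. w i * nat \<bar>r (i + 4)\<bar>)) (s' + 7, r)"
      using Suc.IH[of "s' + 7"] unfolding V_def by blast
    \<comment> \<open>A nonzero coordinate \<open>n\<close> below \<open>a n\<close> in absolute
      value would contradict the minimality of \<open>a\<close>, up to sign.\<close>
    have in_L: "V (Suc n) r \<in> L \<longleftrightarrow> r n = 0 \<and> V n r \<in> L" if "\<bar>r n\<bar> < a n" for r
    proof (cases "r n = 0")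
      case False
      have "V (Suc n) r \<notin> L"
      proof
        assume V: "V (Suc n) r \<in> L"
        then consider "V (Suc n) r \<in> S" | "(\<lambda>i. - V (Suc n) r i) \<in> S"
          using False neg[OF V] unfolding S_def by (force simp: V_def)
        then show False
        proof cases
          case 1
          from min[OF this] show False using that an by (simp add: V_def)
        next
          case 2
          from min[OF this] show False using that an by (simp add: V_def)
        qed
      qed
      with False show ?thesis by simp
    qed (simp add: V_Suc)
    have shift_L: "V (Suc n) v' \<in> L \<longleftrightarrow> V (Suc n) v \<in> L"
      if k: "\<bar>k\<bar> = 1" and v': "\<And>i. i \<le> n \<Longrightarrow> v' i = v i + k * a i" for v v' k
    proof -
      have eq: "V (Suc n) v' = (\<lambda>i. V (Suc n) v i + k * a i)"
        using v' a0 by (auto simp: V_def fun_eq_iff)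
      have ka: "(\<lambda>i. k * a i) \<in> L"
        using k aL neg[OF aL] by (cases "k = 1") (auto simp: abs_if split: if_splits)
      show ?thesis
      proof
        assume "V (Suc n) v' \<in> L"
        from diff[OF this ka] show "V (Suc n) v \<in> L"
          by (simp add: eq)
      next
        assume "V (Suc n) v \<in> L"
        from add[OF this ka] show "V (Suc n) v' \<in> L"
          by (simp add: eq)
      qed
    qed
    have V_cong: "V (Suc n) v' = V (Suc n) v" if "\<And>i. i \<le> n \<Longrightarrow> v' i = v i" for v v'
      using that by (auto simp: V_def fun_eq_iff)
    \<comment> \<open>The new weight is the cost per unit of coordinate \<open>n\<close> in
      \<open>halts_reduce\<close>.\<close>
    define w' where "w' = w(n := 2 * n + 10 + (\<Sum>i<n. w i * nat \<bar>a i\<bar>))"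
    have "halts P inp (V (Suc n) (\<lambda>i. r (i + 4)) \<in> L)
        (K + 6 + 8 + (\<Sum>i<Suc n. w' i * nat \<bar>r (i + 4)\<bar>)) (s, r)"
      if code: "drop s P = reduce a n s @ zero_test (n + 4) s' @ C" for P inp r
    proof -
      let ?b = "V (Suc n) (\<lambda>i. r (i + 4)) \<in> L"
      have code': "drop s' P = zero_test (n + 4) s' @ C"
        using drop_append_eq[OF code] by (simp add: length_reduce s'_def add.assoc)
      have C: "drop (s' + 7) P = C"
        using drop_append_eq[OF code'] by (simp add: zero_test_def numeral_eq_Suc)
      have "halts P inp ?b (K + 6 + 8 + (\<Sum>i<n. w i * nat \<bar>r (i + 4)\<bar>)
          + (2 * n + 10 + (\<Sum>i<n. w i * nat \<bar>a i\<bar>)) * nat \<bar>r (n + 4)\<bar>) (s, r)"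
      \<comment> \<open>The loop invariant: the current vector lies in \<open>L\<close> iff the
        initial one does. Adding or subtracting \<open>a\<close> preserves it because
        \<open>a\<close> is in \<open>L\<close>.\<close>
      proof (rule halts_reduce[OF code an, where I = "\<lambda>v. V (Suc n) v \<in> L \<longleftrightarrow> ?b"])
        fix r' :: "nat \<Rightarrow> int"
        assume small: "\<bar>r' (n + 4)\<bar> < a n" and I: "V (Suc n) (\<lambda>i. r' (i + 4)) \<in> L \<longleftrightarrow> ?b"
        have "halts P inp (r' (n + 4) = 0 \<and> V n (\<lambda>i. r' (i + 4)) \<in> L)
            (K + (\<Sum>i<n. w i * nat \<bar>r' (i + 4)\<bar>) + 6) (s', r')"
        proof (rule halts_zero_test[OF code'])
          fix r'' :: "nat \<Rightarrow> int" assume "\<And>i. r'' (i + 4) = r' (i + 4)"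
          then show "halts P inp (V n (\<lambda>i. r' (i + 4)) \<in> L)
              (K + (\<Sum>i<n. w i * nat \<bar>r' (i + 4)\<bar>)) (s' + 7, r'')"
            using IH[OF C, of inp r''] by simp
        qed simp
        moreover have "?b \<longleftrightarrow> r' (n + 4) = 0 \<and> V n (\<lambda>i. r' (i + 4)) \<in> L"
          using in_L[of "\<lambda>i. r' (i + 4)"] small I by simp
        ultimately show "halts P inp ?b (K + 6 + (\<Sum>i<n. w i * nat \<bar>r' (i + 4)\<bar>))
            (s + 16 + 4 * n, r')"
          unfolding s'_def by (simp only: add.assoc add.commute[of _ 6])
      next
        fix v v' :: "nat \<Rightarrow> int" and k :: int
        assume "\<bar>k\<bar> = 1" "V (Suc n) v \<in> L \<longleftrightarrow> ?b" "\<And>i. i \<le> n \<Longrightarrow> v' i = v i + k * a i"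
        then show "V (Suc n) v' \<in> L \<longleftrightarrow> ?b"
          using shift_L by metis
      next
        fix v v' :: "nat \<Rightarrow> int"
        assume "V (Suc n) v \<in> L \<longleftrightarrow> ?b" "\<And>i. i \<le> n \<Longrightarrow> v' i = v i"
        then show "V (Suc n) v' \<in> L \<longleftrightarrow> ?b"
          using V_cong by metis
      qed (rule refl)
      then show ?thesis
        by (rule halts_mono) (simp add: w'_def)
    qed
    then show ?thesis
      unfolding V_def
      by (intro exI[of _ "reduce a n s @ zero_test (n + 4) s' @ C"] exI[of _ "K + 6 + 8"]
          exI[of _ w'])
        blast
  qed
qed

section \<open>Counting letters and testing their sum\<close>

text \<open>Register 1 is the reading position and register 3 the address of the current counter.
  Letters are positive and a read past the end yields 0, so the first jump detects the end of the
  input; the exit is to address 12, just behind this code.\<close>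

definition count_letters :: "instr list" where
  "count_letters = [Input 0 1, JumpPos 0 4, Const 2 1, JumpPos 2 12, Const 2 4, Add 3 0 2,
    Load 0 3, Const 2 1, Add 0 0 2, Store 3 0, Add 1 1 2, JumpPos 2 0]"

lemma halts_count_letters:
  assumes code: "drop 0 P = count_letters @ D" and pos: "0 \<notin> set ns"
    and exit: "\<And>r. (\<And>i. r (i + 4) = int (count (mset ns) i)) \<Longrightarrow>
      halts P (map int ns) b T (12, r)"
    and "k \<le> length ns" "r 1 = int k" "\<And>i. r (i + 4) = int (count (mset (take k ns)) i)"
  shows "halts P (map int ns) b (T + 4 + 12 * (length ns - k)) (0, r)"
  using assms(4-)
\<comment> \<open>The induction is on the number of unread letters. An iteration runs ten
  instructions, within the allowance of twelve; the exit takes four.\<close>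
proof (induction "length ns - k" arbitrary: k r)
  case 0
  note D = code[unfolded count_letters_def]
  have "halts P (map int ns) b (Suc (Suc (Suc (Suc T)))) (0, r)"
    using 0
    apply -
    apply (rule halts_exec[OF _ D, of _ 0], simp, simp, simp, simp)
    apply (rule halts_exec[OF _ D, of _ 1], simp, simp, simp, simp)
    apply (rule halts_exec[OF _ D, of _ 2], simp, simp, simp, simp)
    apply (rule halts_exec[OF _ D, of _ 3], simp, simp, simp, simp)
    by (rule exit) simp
  then show ?case
    by (rule halts_mono) simp
next
  case (Suc l)
  note D = code[unfolded count_letters_def]
  let ?c = "ns ! k"
  have k: "k < length ns" "l = length ns - Suc k"
    using Suc.hyps(2) by simp_all
  then have c: "?c > 0"
    using pos by (metis gr0I nth_mem)
  define r' where "r' = r(2 := 1, 3 := int ?c + 4, 0 := r (?c + 4) + 1,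
    ?c + 4 := r (?c + 4) + 1, 1 := int k + 1)"
  define T' where "T' = T + 4 + 12 * (length ns - Suc k)"
  have "halts P (map int ns) b T' (0, r')"
    unfolding T'_def using Suc.prems k
    by (intro Suc.hyps(1)) (auto simp: r'_def take_Suc_conv_app_nth)
  then have "halts P (map int ns) b (Suc (Suc (Suc (Suc (Suc (Suc (Suc (Suc (Suc (Suc
      T')))))))))) (0, r)"
    using Suc.prems k c nat_int_add[of ?c 4, simplified]
    apply -
    apply (rule halts_exec[OF _ D, of _ 0], simp, simp, simp, simp)
    apply (rule halts_exec[OF _ D, of _ 1], simp, simp, simp, simp)
    apply (rule halts_exec[OF _ D, of _ 4], simp, simp, simp, simp)
    apply (rule halts_exec[OF _ D, of _ 5], simp, simp, simp, simp)
    apply (rule halts_exec[OF _ D, of _ 6], simp, simp, simp, simp)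
    apply (rule halts_exec[OF _ D, of _ 7], simp, simp, simp, simp)
    apply (rule halts_exec[OF _ D, of _ 8], simp, simp, simp, simp)
    apply (rule halts_exec[OF _ D, of _ 9], simp, simp, simp, simp)
    apply (rule halts_exec[OF _ D, of _ 10], simp, simp, simp, simp)
    apply (rule halts_exec[OF _ D, of _ 11], simp, simp, simp)
    apply (simp add: r'_def nat_add_distrib fun_upd_twist)
    done
  then show ?case
    by (rule halts_mono) (use k in \<open>simp add: T'_def\<close>)
qed

text \<open>The sum depends only on the counts of the letters below \<open>N\<close>, and the count
  vectors of value 0 lie in a subgroup of the integer vectors, to which the lattice test
  applies.\<close>

lemma exists_sum_test:
  fixes g :: "nat \<Rightarrow> 'c::ab_group_add"
  assumes g0: "\<And>i. i \<ge> N \<Longrightarrow> g i = 0"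
  shows "\<exists>(P :: instr list) (p :: nat poly). \<forall>ns. 0 \<notin> set ns \<longrightarrow>
    answers_within P (map int ns) (poly p (length ns)) (sum_list (map g ns) = 0)"
proof -
  \<comment> \<open>Differences of multisets replace integer combinations of the values \<open>g i\<close>.\<close>
  define L where "L = {v. \<exists>M M'. (\<forall>i. v i = int (count M i) - int (count M' i)) \<and>
    (\<Sum>x\<in>#M. g x) = (\<Sum>x\<in>#M'. g x)}"
  have zero: "(\<lambda>_. 0) \<in> L"
    unfolding L_def by (auto intro!: exI[of _ "{#}"])
  have diff: "(\<lambda>i. u i - v i) \<in> L" if "u \<in> L" "v \<in> L" for u v
  proof -
    from that obtain M M' N N' where
      "\<And>i. u i = int (count M i) - int (count M' i)" "(\<Sum>x\<in>#M. g x) = (\<Sum>x\<in>#M'. g x)"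
      "\<And>i. v i = int (count N i) - int (count N' i)" "(\<Sum>x\<in>#N. g x) = (\<Sum>x\<in>#N'. g x)"
      unfolding L_def by blast
    then show ?thesis
      unfolding L_def by - (rule CollectI, rule exI[of _ "M + N'"], rule exI[of _ "M' + N"], simp)
  qed
  have in_L: "(\<lambda>i. if i < N then int (count (mset ns) i) else 0) \<in> L \<longleftrightarrow> sum_list (map g ns) = 0" for ns
  proof -
    define M0 where "M0 = mset (filter (\<lambda>i. i < N) ns)"
    have v: "(\<lambda>i. if i < N then int (count (mset ns) i) else 0) = (\<lambda>i. int (count M0 i))"
      by (auto simp: M0_def)
    have sum: "sum_list (map g ns) = (\<Sum>x\<in>#M0. g x)"
      unfolding M0_def by (induction ns) (auto simp: g0)
    show ?thesis
      unfolding v sum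
    proof
      assume "(\<lambda>i. int (count M0 i)) \<in> L"
      then obtain M M' where *: "\<And>i. int (count M0 i) = int (count M i) - int (count M' i)"
        "(\<Sum>x\<in>#M. g x) = (\<Sum>x\<in>#M'. g x)"
        unfolding L_def by blast
      have "M = M0 + M'"
      proof (rule multiset_eqI)
        show "count M i = count (M0 + M') i" for i
          using *(1)[of i] by simp
      qed
      with *(2) show "(\<Sum>x\<in>#M0. g x) = 0"
        by simp
    next
      assume "(\<Sum>x\<in>#M0. g x) = 0"
      then show "(\<lambda>i. int (count M0 i)) \<in> L"
        unfolding L_def by - (rule CollectI, rule exI[of _ M0], rule exI[of _ "{#}"], simp)
    qed
  qed
  obtain C K w where test: "\<And>P inp r. drop 12 P = C \<Longrightarrow>
      halts P inp ((\<lambda>i. if i < N then r (i + 4) else 0) \<in> L)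
        (K + (\<Sum>i<N. w i * nat \<bar>r (i + 4)\<bar>)) (12, r)"
    using exists_lattice_test[of L 12 N, OF zero diff] by blast
  define P where "P = count_letters @ C"
  \<comment> \<open>Every counter is at most the input length, so the lattice test takes at most
    \<open>K\<close> plus the sum of the weights times that length; counting adds 4 and 12 per
    letter.\<close>
  define p where "p = [:K + 4, (\<Sum>i<N. w i) + 12:]"
  have "answers_within P (map int ns) (poly p (length ns)) (sum_list (map g ns) = 0)"
    if ns: "0 \<notin> set ns" for ns
  proof (rule halts_imp_answers_within)
    let ?T = "K + (\<Sum>i<N. w i) * length ns"
    have C: "drop 12 P = C"
      by (simp add: P_def count_letters_def)
    have "halts P (map int ns) (sum_list (map g ns) = 0) (?T + 4 + 12 * (length ns - 0)) (0, \<lambda>_. 0)"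
    proof (rule halts_count_letters[OF _ ns])
      show "drop 0 P = count_letters @ C"
        by (simp add: P_def)
      fix r :: "nat \<Rightarrow> int"
      assume r: "\<And>i. r (i + 4) = int (count (mset ns) i)"
      have "halts P (map int ns) (sum_list (map g ns) = 0)
          (K + (\<Sum>i<N. w i * nat \<bar>r (i + 4)\<bar>)) (12, r)"
        using test[OF C, of "map int ns" r] by (simp add: r in_L cong: if_cong)
      moreover have "(\<Sum>i<N. w i * nat \<bar>r (i + 4)\<bar>) \<le> (\<Sum>i<N. w i) * length ns"
        unfolding sum_distrib_right
        by (intro sum_mono mult_left_mono) (simp_all add: r, metis count_le_size size_mset)
      ultimately show "halts P (map int ns) (sum_list (map g ns) = 0) ?T (12, r)"
        by (rule halts_mono[OF _ add_left_mono])
    qed simp_all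
    then show "halts P (map int ns) (sum_list (map g ns) = 0) (poly p (length ns)) (0, \<lambda>_. 0)"
      by (rule halts_mono) (simp add: p_def algebra_simps)
  qed
  then show ?thesis
    by blast
qed

section \<open>Letter codes and the decision procedure\<close>

text \<open>Variable indices are unbounded but contribute 0, while a generator of index
  \<open>i\<close> has code at most \<open>10 * i + 10\<close>. Thus a fixed number of counters
  suffices for all instances.\<close>

lemma code_of_instance_letter:
  assumes "set cs \<subseteq> const_words as bs" "l \<in> set (quadratic_word g cs)"
  shows "letter_total as bs l = 0 \<or> letter_code l < 10 * int (length as + length bs) + 11"
proof (cases "\<exists>v. l = Pos (Var v) \<or> l = Inv (Var v)")
  case True
  then show ?thesis
    by (auto simp: letter_total_def abelianization_inv)
next
  case False
  with assms(2) obtain j l' where j: "j < length cs" "l' \<in> set (cs ! j)" "l = map_letter Gen l'"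
    by (auto simp: quadratic_word_def commutator_word_def conjugate_word_def)
  then have "\<forall>s\<in>set_letter l'. gen_ok as bs s"
    using assms(1) nth_mem[OF j(1)] unfolding const_words_def by blast
  then have "letter_code l < 10 * int (length as + length bs) + 11"
  proof (cases l')
    case (Pos s)
    then show ?thesis
      using j(3) \<open>\<forall>s\<in>set_letter l'. gen_ok as bs s\<close> by (cases s) auto
  next
    case (Inv s)
    then show ?thesis
      using j(3) \<open>\<forall>s\<in>set_letter l'. gen_ok as bs s\<close> by (cases s) auto
  qed
  then show ?thesis ..
qed

theorem corollary5p4:
  fixes as :: "'a::ab_group_add list" and bs :: "'b::ab_group_add list"
  assumes "group_closure (set as) = UNIV"
    and "group_closure (set bs) = UNIV"
  shows "decidable_in_P (map letter_code)
    {quadratic_word g cs | g cs.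
      g \<ge> 1 \<and> real g \<ge> real (group_rank (UNIV :: 'b set)) / 2 \<and> set cs \<subseteq> const_words as bs}
    (solvable as bs)"
proof -
  define N where "N = 10 * (length as + length bs) + 11"
  define code where "code l = nat (letter_code l)" for l
  have int_code: "int (code l) = letter_code l" and code_nz: "code l \<noteq> 0" for l
    by (cases l; simp add: code_def)+
  have inj: "inj code"
    using inj_letter_code int_code by (intro injI) (metis injD)
  \<comment> \<open>The cutoff at \<open>N\<close> is harmless: in an instance, letters with larger
    codes have total 0.\<close>
  define v where "v n = (if n < N then letter_total as bs (inv_into UNIV code n) else 0)" for n
  have "v n = 0" if "n \<ge> N" for n
    using that by (simp add: v_def)
  from exists_sum_test[of N v, OF this] obtain P p where
    P: "\<And>ns. 0 \<notin> set ns \<Longrightarrow>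
      answers_within P (map int ns) (poly p (length ns)) (sum_list (map v ns) = 0)"
    by blast
  have "answers_within P (map letter_code w) (poly p (length (map letter_code w))) (solvable as bs w)"
    if w: "w = quadratic_word g cs" and "real g \<ge> real (group_rank (UNIV :: 'b set)) / 2"
      and cs: "set cs \<subseteq> const_words as bs" for w g cs
  proof -
    have "group_rank (UNIV :: 'b set) \<le> 2 * g"
      using that(2) by linarith
    then have solv: "solvable as bs w \<longleftrightarrow> sum_list (map (letter_total as bs) w) = 0"
      unfolding w by (rule solvable_quadratic_word_iff[OF assms(2)])
    have "v (code l) = letter_total as bs l" if "l \<in> set w" for l
      using code_of_instance_letter[OF cs that[unfolded w]] int_code[of l]
      by (auto simp: v_def N_def inv_f_f[OF inj])
    then have vals: "map v (map code w) = map (letter_total as bs) w"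
      by simp
    have "0 \<notin> set (map code w)"
      using code_nz by (metis (mono_tags) ex_map_conv)
    from P[OF this] show ?thesis
      by (simp only: solv vals length_map) (simp add: int_code comp_def)
  qed
  then show ?thesis
    unfolding decidable_in_P_def by blast
qed

end
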